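(* Let $U$ be a non-empty finite set and let $R\subseteq U\times U$ be a binary relation on $U$. If $R$ is serial, then for all $X\subseteq U$, $$\underline{apr}_{p\vee s}(X)\subseteq\underline{apr}_{s}(X)\subseteq\overline{apr}_{s}(X)\subseteq\overline{apr}_{p\vee s}(X).$$
   Context: $R$ is serial if for each $x\in U$ there exists $y\in U$ with $(x,y)\in R$. For $x\in U$ put $R_s(x)=\{y\in U\mid (x,y)\in R\}$, $R_p(x)=\{y\in U\mid (y,x)\in R\}$, $R_{p\vee s}(x)=R_s(x)\cup R_p(x)$. For $i\in\{s,p\vee s\}$ and $X\subseteq U$, $\underline{apr}_i(X)=\{x\in U\mid R_i(x)\subseteq X\}$ and $\overline{apr}_i(X)=\{x\in U\mid R_i(x)\cap X\neq\emptyset\}$. *)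

theory Defs
  imports Main
begin

definition serial_on :: "'a set \<Rightarrow> 'a rel \<Rightarrow> bool" where
  "serial_on U R \<longleftrightarrow> (\<forall>x\<in>U. \<exists>y\<in>U. (x, y) \<in> R)"

definition succ_nbhd :: "'a set \<Rightarrow> 'a rel \<Rightarrow> 'a \<Rightarrow> 'a set" where
  "succ_nbhd U R x = {y \<in> U. (x, y) \<in> R}"

definition pred_nbhd :: "'a set \<Rightarrow> 'a rel \<Rightarrow> 'a \<Rightarrow> 'a set" where
  "pred_nbhd U R x = {y \<in> U. (y, x) \<in> R}"

definition pred_or_succ_nbhd :: "'a set \<Rightarrow> 'a rel \<Rightarrow> 'a \<Rightarrow> 'a set" where
  "pred_or_succ_nbhd U R x = succ_nbhd U R x \<union> pred_nbhd U R x"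

(* The approximations take an arbitrary neighbourhood operator N on the universe U,
   so that apr_s and apr_{p or s} are instances of a single pair of definitions. *)

definition lower_apr :: "'a set \<Rightarrow> ('a \<Rightarrow> 'a set) \<Rightarrow> 'a set \<Rightarrow> 'a set" where
  "lower_apr U N X = {x \<in> U. N x \<subseteq> X}"

definition upper_apr :: "'a set \<Rightarrow> ('a \<Rightarrow> 'a set) \<Rightarrow> 'a set \<Rightarrow> 'a set" where
  "upper_apr U N X = {x \<in> U. N x \<inter> X \<noteq> {}}"

end

theory Submission
  imports Defs
begin

text \<open>Enlarging every neighbourhood makes containment in \<open>X\<close> harder and meeting
  \<open>X\<close> easier. Since successor neighbourhoods lie inside the combined ones, this gives
  the two outer inclusions (\<open>lower_apr_antimono\<close>, \<open>upper_apr_mono\<close>). The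
  middle one, \<open>lower_apr_subset_upper_apr\<close>, rests on seriality, which makes successor
  neighbourhoods nonempty.\<close>

lemma lower_apr_antimono:
  assumes "\<And>x. x \<in> U \<Longrightarrow> N x \<subseteq> M x"
  shows "lower_apr U M X \<subseteq> lower_apr U N X"
  using assms by (fastforce simp: lower_apr_def)

lemma upper_apr_mono:
  assumes "\<And>x. x \<in> U \<Longrightarrow> N x \<subseteq> M x"
  shows "upper_apr U N X \<subseteq> upper_apr U M X"
  using assms by (fastforce simp: upper_apr_def)

text \<open>A nonempty set contained in \<open>X\<close> meets \<open>X\<close>: any element of
  \<open>N x\<close> serves as witness.\<close>

lemma lower_apr_subset_upper_apr:
  assumes "\<And>x. x \<in> U \<Longrightarrow> N x \<noteq> {}"
  shows "lower_apr U N X \<subseteq> upper_apr U N X"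
  using assms by (fastforce simp: lower_apr_def upper_apr_def)

lemma succ_nbhd_nonempty:
  assumes "serial_on U R" and "x \<in> U"
  shows "succ_nbhd U R x \<noteq> {}"
  using assms by (auto simp: serial_on_def succ_nbhd_def)

lemma succ_nbhd_subset: "succ_nbhd U R x \<subseteq> pred_or_succ_nbhd U R x"
  by (simp add: pred_or_succ_nbhd_def)

theorem corollary24:
  fixes U :: "'a set" and R :: "'a rel"
  assumes "finite U" and "U \<noteq> {}"
    and "R \<subseteq> U \<times> U"
    and "serial_on U R"
  shows "\<forall>X\<subseteq>U.
      lower_apr U (pred_or_succ_nbhd U R) X \<subseteq> lower_apr U (succ_nbhd U R) X \<and>
      lower_apr U (succ_nbhd U R) X \<subseteq> upper_apr U (succ_nbhd U R) X \<and>
      upper_apr U (succ_nbhd U R) X \<subseteq> upper_apr U (pred_or_succ_nbhd U R) X"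
  \<comment> \<open>Seriality feeds \<open>succ_nbhd_nonempty\<close> in the middle inclusion; its
    premises, seriality and \<open>x \<in> U\<close>, close by assumption.\<close>
  using assms(4)
  by (intro allI impI conjI lower_apr_antimono upper_apr_mono lower_apr_subset_upper_apr
      succ_nbhd_subset succ_nbhd_nonempty)

end
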